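(* Let $c\geq 1$ and $t\geq 1$ be integers and let $n=c(2t+1)$. Then $h_1(\Delta^{[n]})=n/3$.
   Context: $[n]=\{1,\dots,n\}$ and $\Delta^{[n]}$ denotes the full simplex on the vertex set $[n]$ (all subsets of $[n]$ are simplices). For a finite simplicial complex $X$, let $C^k(X)$ be the $k$-cochains with $\mathbb{Z}_2$-coefficients, and let $\partial^*$ be the coboundary operator. For a cochain $c$, the norm $\|c\|$ is the number of $k$-simplices on which $c$ takes the value $1$. The cosystolic norm of a $k$-cochain $c$ is $\|c\|_{\mathrm{csy}}:=\min_{d\in C^{k-1}(X)}\|c+\partial^* d\|$. The $k$-th Cheeger constant of $X$ is $h_k(X):=\min_c \|\partial^* c\|/\|c\|_{\mathrm{csy}}$, where the minimum is taken over all $c\in C^k(X)$ which are not coboundaries. The number $h_1(\Delta^{[n]})$ is considered for $n\ge 3$. *)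

theory Defs
  imports Complex_Main "HOL-Library.Z2"
begin

text \<open>
  The empty simplex is a simplex (of dimension -1) of every nonempty complex, and the dimension
  \<open>k\<close> is an integer, so that \<open>k - 1\<close> makes sense for \<open>k = 0\<close>.
\<close>

definition finite_simplicial_complex :: "'a set set \<Rightarrow> bool" where
  "finite_simplicial_complex X \<longleftrightarrow>
     finite X \<and> (\<forall>\<sigma>\<in>X. finite \<sigma>) \<and> (\<forall>\<sigma>\<in>X. \<forall>\<tau>. \<tau> \<subseteq> \<sigma> \<longrightarrow> \<tau> \<in> X)"

definition simplices :: "int \<Rightarrow> 'a set set \<Rightarrow> 'a set set" where
  "simplices k X = {\<sigma> \<in> X. int (card \<sigma>) = k + 1}"

definition full_simplex :: "'a set \<Rightarrow> 'a set set" where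
  "full_simplex V = Pow V"

text \<open>
  A \<open>k\<close>-cochain is represented by its extension by zero to all sets, so that equality of
  cochains is equality of functions.
\<close>

definition cochains :: "int \<Rightarrow> 'a set set \<Rightarrow> ('a set \<Rightarrow> bit) set" where
  "cochains k X = {c. \<forall>\<sigma>. \<sigma> \<notin> simplices k X \<longrightarrow> c \<sigma> = 0}"

definition coboundary :: "int \<Rightarrow> 'a set set \<Rightarrow> ('a set \<Rightarrow> bit) \<Rightarrow> 'a set \<Rightarrow> bit" where
  "coboundary k X c \<tau> =
     (if \<tau> \<in> simplices (k + 1) X then \<Sum>\<sigma> | \<sigma> \<in> simplices k X \<and> \<sigma> \<subseteq> \<tau>. c \<sigma> else 0)"

definition coboundaries :: "int \<Rightarrow> 'a set set \<Rightarrow> ('a set \<Rightarrow> bit) set" where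
  "coboundaries k X = coboundary (k - 1) X ` cochains (k - 1) X"

definition cochain_norm :: "int \<Rightarrow> 'a set set \<Rightarrow> ('a set \<Rightarrow> bit) \<Rightarrow> nat" where
  "cochain_norm k X c = card {\<sigma> \<in> simplices k X. c \<sigma> = 1}"

definition cosystolic_norm :: "int \<Rightarrow> 'a set set \<Rightarrow> ('a set \<Rightarrow> bit) \<Rightarrow> nat" where
  "cosystolic_norm k X c =
     Min ((\<lambda>d. cochain_norm k X (\<lambda>\<sigma>. c \<sigma> + coboundary (k - 1) X d \<sigma>)) ` cochains (k - 1) X)"

text \<open>Meaningful only if not every \<open>k\<close>-cochain is a coboundary.\<close>

definition cheeger_constant :: "int \<Rightarrow> 'a set set \<Rightarrow> real" where
  "cheeger_constant k X =
     Min ((\<lambda>c. real (cochain_norm (k + 1) X (coboundary k X c)) / real (cosystolic_norm k X c))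
          ` (cochains k X - coboundaries k X))"

lemma finite_simplicial_complex_full_simplex:
  "finite V \<Longrightarrow> finite_simplicial_complex (full_simplex V)"
  unfolding finite_simplicial_complex_def full_simplex_def
  by (auto intro: finite_subset)

lemma finite_cochains:
  assumes "finite_simplicial_complex X"
  shows "finite (cochains k X)"
proof -
  have "finite (simplices k X)"
    using assms by (simp add: simplices_def finite_simplicial_complex_def)
  moreover have "finite (UNIV :: bit set)"
  proof (rule finite_subset)
    show "(UNIV :: bit set) \<subseteq> {0, 1}"
      by (metis bit_not_one_iff insertI1 insertI2 subsetI)
  qed simp
  ultimately have "finite {c :: 'a set \<Rightarrow> bit. \<forall>\<sigma>. (\<sigma> \<in> simplices k X \<longrightarrow> c \<sigma> \<in> UNIV) \<and>
      (\<sigma> \<notin> simplices k X \<longrightarrow> c \<sigma> = 0)}"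
    by (rule finite_set_of_finite_funs)
  then show ?thesis
    by (simp add: cochains_def)
qed

end

theory Submission imports Defs begin

text \<open>
  A 1-cochain is a graph \<open>f\<close> on the vertex set, adding \<open>\<partial>\<^sup>* d\<close> switches it along the cut given by \<open>d\<close>,
  and the coboundary of \<open>f\<close> marks the odd triangles: those that contain one or three edges of \<open>f\<close>.

  \<^emph>\<open>Lower bound.\<close> Switching along the neighbourhood of a vertex \<open>v\<close> isolates \<open>v\<close>, and the edges that remain
  are the sides opposite to \<open>v\<close> of the odd triangles at \<open>v\<close>. So at least \<open>\<parallel>f\<parallel>\<^sub>c\<^sub>s\<^sub>y\<close> odd triangles pass
  through every vertex, and summing over the \<open>n\<close> vertices counts every odd triangle three times. This
  gives \<open>n \<parallel>f\<parallel>\<^sub>c\<^sub>s\<^sub>y \<le> 3 \<parallel>\<partial>\<^sup>* f\<parallel>\<close> (\<open>card_times_cosystolic_norm_le\<close>) for every \<open>n\<close>.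

  \<^emph>\<open>A graph that attains it.\<close> Label the vertices by \<open>0, \<dots>, 2t\<close>, each label being used \<open>c\<close> times, and join two
  vertices when their labels differ by more than \<open>t\<close>. Geometrically, the labels are \<open>2t + 1\<close> rays with
  equal gaps of \<open>\<pi> / (2t + 1)\<close> in an open half-plane; edges are the obtuse pairs, and switching replaces
  rays by their opposites. The \<open>2t + 1\<close> lines are permuted transitively by a rotation, which is why all vertices lie
  on equally many odd triangles. There are at most \<open>c\<^sup>3 t (t + 1) (2t + 1) / 6\<close> odd triangles (\<open>odd_triangles_le\<close>),
  so what remains is that no switching of the graph has fewer than \<open>c\<^sup>2 t (t + 1) / 2\<close> edges
  (\<open>threshold_graph_norm_ge\<close>).

  Write \<open>S i j = -1\<close> if \<open>i\<close> and \<open>j\<close> differ by more than \<open>t\<close> and \<open>S i j = 1\<close> otherwise. With \<open>X i\<close> the sum over the vertices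
  labelled \<open>i\<close> of the signs of the switching, this edge count becomes the inequality
  \<open>(\<Sum>i j. S i j * X i * X j) \<le> c\<^sup>2 (2t\<^sup>2 + 2t + 1)\<close> for \<open>\<bar>X i\<bar> \<le> c\<close> (\<open>band_form_le\<close>). The left side is at most \<open>c\<close> times
  the sum of the \<open>\<bar>Y k\<bar>\<close>, where \<open>Y k = (\<Sum>j. S k j * X j)\<close> is a signed sum over a half-circle of rays. Moving the
  half-circle by one ray changes \<open>Y\<close> by at most \<open>2c\<close>, and half a turn changes its sign. Hence \<open>Y\<close> crosses
  zero, it can only grow linearly with the distance from the crossing and from its antipode, and so \<open>\<bar>Y\<bar>\<close> lies
  under a tent whose total is \<open>c (2t\<^sup>2 + 2t + 1)\<close> (\<open>antiperiodic_sum_abs_le\<close>).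
\<close>

section \<open>Low-dimensional cochains of the full simplex\<close>

text \<open>
  Cochains are added in a field of characteristic two here; rewriting sums into exclusive or
  would hide the ring structure from the simplifier.
\<close>

declare add_bit_eq_xor [simp del]

lemma bit_add_eq_0_iff: "a + b = 0 \<longleftrightarrow> a = (b :: bit)"
  by (cases a; cases b) auto

lemma simplices_full_simplex:
  "simplices 0 (full_simplex V) = {\<sigma>. \<sigma> \<subseteq> V \<and> card \<sigma> = 1}"
  "simplices 1 (full_simplex V) = {\<sigma>. \<sigma> \<subseteq> V \<and> card \<sigma> = 2}"
  "simplices 2 (full_simplex V) = {\<sigma>. \<sigma> \<subseteq> V \<and> card \<sigma> = 3}"
  by (auto simp: simplices_def full_simplex_def)

lemma finite_simplices_full_simplex:
  "finite V \<Longrightarrow> finite (simplices k (full_simplex V))"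
  by (simp add: simplices_def full_simplex_def)

lemma coboundary_0_edge:
  assumes "u \<in> V" "v \<in> V" "u \<noteq> v"
  shows "coboundary 0 (full_simplex V) d {u, v} = d {u} + d {v}"
proof -
  have "{\<sigma>. \<sigma> \<in> simplices 0 (full_simplex V) \<and> \<sigma> \<subseteq> {u, v}} = {{u}, {v}}"
    using assms by (auto simp: simplices_full_simplex card_1_singleton_iff)
  then show ?thesis
    using assms by (simp add: coboundary_def simplices_full_simplex)
qed

lemma coboundary_1_triangle:
  assumes "u \<in> V" "v \<in> V" "w \<in> V" "u \<noteq> v" "u \<noteq> w" "v \<noteq> w"
  shows "coboundary 1 (full_simplex V) f {u, v, w} = f {u, v} + f {u, w} + f {v, w}"
proof -
  have "{\<sigma>. \<sigma> \<in> simplices 1 (full_simplex V) \<and> \<sigma> \<subseteq> {u, v, w}} = {{u, v}, {u, w}, {v, w}}"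
    using assms by (auto simp: simplices_full_simplex card_2_iff doubleton_eq_iff)
  moreover have "{u, v} \<noteq> {u, w}" "{u, v} \<noteq> {v, w}" "{u, w} \<noteq> {v, w}"
    using assms by (auto simp: doubleton_eq_iff)
  ultimately show ?thesis
    using assms by (simp add: coboundary_def simplices_full_simplex add.assoc)
qed

lemma cochain_norm_eq_0_iff:
  assumes "finite V" "c \<in> cochains k (full_simplex V)"
  shows "cochain_norm k (full_simplex V) c = 0 \<longleftrightarrow> c = (\<lambda>_. 0)"
  using assms finite_simplices_full_simplex[OF assms(1), of k]
  by (auto simp: cochain_norm_def cochains_def fun_eq_iff)

lemma coboundary_in_cochains: "coboundary (k - 1) X d \<in> cochains k X"
  by (simp add: cochains_def coboundary_def)

lemma finite_cosystolic_candidates: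
  "finite V \<Longrightarrow> finite ((\<lambda>d. cochain_norm k (full_simplex V)
      (\<lambda>\<sigma>. c \<sigma> + coboundary (k - 1) (full_simplex V) d \<sigma>)) ` cochains (k - 1) (full_simplex V))"
  by (intro finite_imageI finite_cochains finite_simplicial_complex_full_simplex)

lemma zero_in_cochains: "(\<lambda>_. 0) \<in> cochains k X"
  by (simp add: cochains_def)

lemma cosystolic_norm_le:
  assumes "finite V" "d \<in> cochains 0 (full_simplex V)"
  shows "cosystolic_norm 1 (full_simplex V) f
    \<le> cochain_norm 1 (full_simplex V) (\<lambda>\<sigma>. f \<sigma> + coboundary 0 (full_simplex V) d \<sigma>)"
  unfolding cosystolic_norm_def
  using assms finite_cosystolic_candidates[of V 1 f] by (intro Min_le) auto

lemma cosystolic_norm_attained: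
  assumes "finite V"
  obtains d where "d \<in> cochains (k - 1) (full_simplex V)"
    and "cosystolic_norm k (full_simplex V) f
      = cochain_norm k (full_simplex V) (\<lambda>\<sigma>. f \<sigma> + coboundary (k - 1) (full_simplex V) d \<sigma>)"
proof -
  have "cosystolic_norm k (full_simplex V) f \<in> (\<lambda>d. cochain_norm k (full_simplex V)
      (\<lambda>\<sigma>. f \<sigma> + coboundary (k - 1) (full_simplex V) d \<sigma>)) ` cochains (k - 1) (full_simplex V)"
    unfolding cosystolic_norm_def
    using finite_cosystolic_candidates[OF assms, of k f] zero_in_cochains
    by (intro Min_in) blast+
  then show thesis using that by blast
qed

text \<open>
  This puts the cochains over which the Cheeger constant is minimized exactly where the quotient
  has a nonzero denominator.
\<close>

lemma cosystolic_norm_eq_0_iff: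
  assumes "finite V" "f \<in> cochains k (full_simplex V)"
  shows "cosystolic_norm k (full_simplex V) f = 0 \<longleftrightarrow> f \<in> coboundaries k (full_simplex V)"
proof -
  let ?X = "full_simplex V"
  have *: "cochain_norm k ?X (\<lambda>\<sigma>. f \<sigma> + coboundary (k - 1) ?X d \<sigma>) = 0
      \<longleftrightarrow> f = coboundary (k - 1) ?X d" for d
  proof -
    have "(\<lambda>\<sigma>. f \<sigma> + coboundary (k - 1) ?X d \<sigma>) \<in> cochains k ?X"
      using assms(2) coboundary_in_cochains[of k ?X d] by (simp add: cochains_def)
    then show ?thesis
      using assms(1) by (simp only: cochain_norm_eq_0_iff) (simp add: fun_eq_iff bit_add_eq_0_iff)
  qed
  show ?thesis
  proof
    assume 0: "cosystolic_norm k ?X f = 0"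
    obtain d where "d \<in> cochains (k - 1) ?X" "cosystolic_norm k ?X f
      = cochain_norm k ?X (\<lambda>\<sigma>. f \<sigma> + coboundary (k - 1) ?X d \<sigma>)"
      using cosystolic_norm_attained[OF assms(1)] by blast
    then show "f \<in> coboundaries k ?X"
      using 0 * by (auto simp: coboundaries_def)
  next
    assume "f \<in> coboundaries k ?X"
    then obtain d where d: "d \<in> cochains (k - 1) ?X" "f = coboundary (k - 1) ?X d"
      by (auto simp: coboundaries_def)
    then have "cosystolic_norm k ?X f \<le> cochain_norm k ?X (\<lambda>\<sigma>. f \<sigma> + coboundary (k - 1) ?X d \<sigma>)"
      unfolding cosystolic_norm_def
      using finite_cosystolic_candidates[OF assms(1), of k f] by (intro Min_le) blast+
    also have "\<dots> = 0" by (rule iffD2[OF * d(2)])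
    finally show "cosystolic_norm k ?X f = 0" by simp
  qed
qed

section \<open>The lower bound: averaging over links\<close>

text \<open>
  Switching along the neighbourhood \<open>d\<close> of \<open>v\<close> deletes all edges at \<open>v\<close>. Away from \<open>v\<close>, the switched value
  on \<open>{x, y}\<close> is \<open>f {x, y} + f {v, x} + f {v, y}\<close>, the coboundary on \<open>{v, x, y}\<close>. So the remaining edges
  correspond to odd triangles at \<open>v\<close>.
\<close>

lemma cosystolic_norm_le_odd_triangles_at:
  assumes "finite V" "v \<in> V"
  shows "cosystolic_norm 1 (full_simplex V) f
    \<le> card {\<tau> \<in> simplices 2 (full_simplex V). coboundary 1 (full_simplex V) f \<tau> = 1 \<and> v \<in> \<tau>}"
    (is "_ \<le> card ?T")
proof -
  let ?X = "full_simplex V"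
  define d where "d \<sigma> = (if \<sigma> \<subseteq> V - {v} \<and> card \<sigma> = 1 then f (insert v \<sigma>) else 0)" for \<sigma>
  let ?g = "\<lambda>\<sigma>. f \<sigma> + coboundary 0 ?X d \<sigma>"
  let ?E = "{\<sigma> \<in> simplices 1 ?X. ?g \<sigma> = 1}"
  have d0: "d \<in> cochains 0 ?X"
    by (auto simp: cochains_def d_def simplices_full_simplex)
  have fT: "finite ?T" by (simp add: assms(1) finite_simplices_full_simplex)
  have star: "v \<notin> e" if e: "e \<in> ?E" for e
  proof
    assume "v \<in> e"
    moreover have "card e = 2" "e \<subseteq> V" using e by (auto simp: simplices_full_simplex)
    ultimately obtain w where w: "e = {v, w}" "w \<noteq> v" "w \<in> V"
      by (auto simp: card_2_iff doubleton_eq_iff)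
    have "?g e = f {v, w} + (d {v} + d {w})"
      unfolding w(1) using w assms(2) by (subst coboundary_0_edge) auto
    also have "\<dots> = 0" using w by (simp add: d_def bit_add_eq_0_iff)
    finally show False using e by simp
  qed
  have "insert v e \<in> ?T" if e: "e \<in> ?E" for e
  proof -
    have "card e = 2" "e \<subseteq> V" using e by (auto simp: simplices_full_simplex)
    then obtain x y where xy: "e = {x, y}" "x \<noteq> y" "x \<in> V" "y \<in> V"
      by (auto simp: card_2_iff)
    have v: "v \<noteq> x" "v \<noteq> y" using star[OF e] xy by auto
    have "?g e = f {x, y} + (f {v, x} + f {v, y})"
      unfolding xy(1) using xy v by (subst coboundary_0_edge) (auto simp: d_def)
    also have "\<dots> = coboundary 1 ?X f {v, x, y}"
      using xy v assms(2) by (simp add: coboundary_1_triangle ac_simps)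
    finally show ?thesis
      using e xy v assms(2) by (simp add: simplices_full_simplex)
  qed
  then have "insert v ` ?E \<subseteq> ?T" by blast
  moreover have "inj_on (insert v) ?E"
    by (rule inj_onI) (metis star insert_ident)
  ultimately have "card ?E \<le> card ?T"
    using fT by (intro card_inj_on_le)
  then show ?thesis
    using cosystolic_norm_le[OF assms(1) d0, of f] by (simp add: cochain_norm_def)
qed

text \<open>
  Double counting of the pairs of a vertex and an odd triangle that contains it.
\<close>

lemma card_times_cosystolic_norm_le:
  assumes "finite V"
  shows "card V * cosystolic_norm 1 (full_simplex V) f
    \<le> 3 * cochain_norm 2 (full_simplex V) (coboundary 1 (full_simplex V) f)"
proof -
  let ?X = "full_simplex V"
  let ?T = "{\<tau> \<in> simplices 2 ?X. coboundary 1 ?X f \<tau> = 1}"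
  have fT: "finite ?T" by (simp add: assms finite_simplices_full_simplex)
  have "card V * cosystolic_norm 1 ?X f = (\<Sum>v\<in>V. cosystolic_norm 1 ?X f)" by simp
  also have "\<dots> \<le> (\<Sum>v\<in>V. card {\<tau> \<in> ?T. v \<in> \<tau>})"
    using cosystolic_norm_le_odd_triangles_at[OF assms]
    by (intro sum_mono) (simp add: conj_assoc)
  also have "\<dots> = 3 * card ?T"
  proof (rule sum_multicount)
    show "\<forall>\<tau>\<in>?T. card {v \<in> V. v \<in> \<tau>} = 3"
    proof
      fix \<tau> assume "\<tau> \<in> ?T"
      then have "{v \<in> V. v \<in> \<tau>} = \<tau>" "card \<tau> = 3" by (auto simp: simplices_full_simplex)
      then show "card {v \<in> V. v \<in> \<tau>} = 3" by simp
    qed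
  qed (use assms fT in auto)
  finally show ?thesis by (simp add: cochain_norm_def)
qed

section \<open>Antiperiodic sequences with bounded steps\<close>

lemma sum_period_shift:
  fixes g :: "nat \<Rightarrow> real"
  assumes "\<And>k. g (k + N) = g k"
  shows "(\<Sum>j<N. g (z + j)) = (\<Sum>j<N. g j)"
proof (induction z)
  case (Suc z)
  have "(\<Sum>j<N. g (Suc z + j)) + g z = (\<Sum>j<Suc N. g (z + j))"
    by (subst sum.lessThan_Suc_shift) simp
  also have "\<dots> = (\<Sum>j<N. g (z + j)) + g z"
    using assms by simp
  finally show ?case using Suc by simp
qed simp

lemma steps_bound:
  fixes F :: "nat \<Rightarrow> real"
  assumes "\<And>k. \<bar>F (Suc k) - F k\<bar> \<le> a"
  shows "\<bar>F (k + j) - F k\<bar> \<le> a * j"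
proof (induction j)
  case (Suc j)
  then show ?case using assms[of "k + j"] by (simp add: algebra_simps)
qed simp

text \<open>
  The sequence crosses zero between some \<open>z\<close> and \<open>z + 1\<close>, and again half a turn later. In the window that
  starts at \<open>z + 1\<close>, values are bounded linearly from both ends. Adding the bounds of the
  positions \<open>j\<close> and \<open>2t - j\<close> makes only \<open>\<bar>F z\<bar> + \<bar>F (z + 1)\<bar> \<le> 2a\<close> matter, so that it does
  not matter where inside the step the crossing lies.
\<close>

lemma antiperiodic_sum_abs_le:
  fixes F :: "nat \<Rightarrow> real"
  assumes anti: "\<And>k. F (k + (2 * t + 1)) = - F k"
    and step: "\<And>k. \<bar>F (Suc k) - F k\<bar> \<le> 2 * a"
  shows "(\<Sum>k<2 * t + 1. \<bar>F k\<bar>) \<le> a * (2 * real t ^ 2 + 2 * real t + 1)"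
proof -
  define N where "N = 2 * t + 1"
  \<comment> \<open>Without a crossing, all values would have the sign of \<open>F 0\<close>, but \<open>F N = - F 0\<close>.\<close>
  have "\<exists>z. F z * F (Suc z) \<le> 0"
  proof (rule ccontr)
    assume "\<not> ?thesis"
    then have pos: "F z * F (Suc z) > 0" for z by (simp add: not_le)
    have "F 0 * F k > 0" for k
    proof (induction k)
      case 0
      show ?case using pos[of 0] by (auto simp: zero_less_mult_iff)
    next
      case (Suc k)
      then show ?case using pos[of k] by (auto simp: zero_less_mult_iff)
    qed
    from this[of N] this[of 0] anti[of 0] show False by (simp add: N_def)
  qed
  then obtain z where z: "F z * F (Suc z) \<le> 0" ..
  define p q where "p = \<bar>F (Suc z)\<bar>" and "q = \<bar>F z\<bar>"
  have pq: "p + q \<le> 2 * a"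
    using z step[of z] by (auto simp: p_def q_def mult_le_0_iff)
  have up: "\<bar>F (Suc z + j)\<bar> \<le> p + 2 * a * j" for j
    using steps_bound[of F "2 * a", OF step, of "Suc z" j] by (simp add: p_def)
  have down: "\<bar>F (Suc z + j)\<bar> \<le> q + 2 * a * real (2 * t - j)" if "j \<le> 2 * t" for j
  proof -
    have "Suc z + j + (2 * t - j) = z + (2 * t + 1)" using that by simp
    then have "F (Suc z + j + (2 * t - j)) = - F z" using anti by simp
    then show ?thesis
      using steps_bound[of F "2 * a", OF step, of "Suc z + j" "2 * t - j"] by (simp add: q_def)
  qed
  let ?G = "\<lambda>j. \<bar>F (Suc z + j)\<bar>"
  have pair: "?G j + ?G (2 * t - j) \<le> 2 * a + 4 * a * j" if "j < t" for j
    using up[of j] down[of "2 * t - j"] that pq by (simp add: algebra_simps)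
  \<comment> \<open>The middle position is bounded from both ends, so the smaller of \<open>p\<close> and \<open>q\<close>, which is at
    most \<open>a\<close>, counts.\<close>
  have mid: "?G t \<le> a + 2 * a * t"
    using up[of t] down[of t] pq by simp
  have split: "(\<Sum>j<2 * t + 1. G j) = (\<Sum>j<t. G j + G (2 * t - j)) + G t" for G :: "nat \<Rightarrow> real"
  proof -
    have halves: "{..<2 * t + 1} = {..<Suc t} \<union> {t<..2 * t}" by auto
    have "(\<Sum>j<2 * t + 1. G j) = sum G {..<Suc t} + sum G {t<..2 * t}"
      unfolding halves by (rule sum.union_disjoint) auto
    moreover have "sum G {t<..2 * t} = (\<Sum>j<t. G (2 * t - j))"
      by (rule sum.reindex_bij_witness[of _ "\<lambda>j. 2 * t - j" "\<lambda>j. 2 * t - j"]) auto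
    ultimately show ?thesis by (simp add: sum.distrib)
  qed
  have gauss: "(\<Sum>j<t. 2 * a + 4 * a * real j) = 2 * a * real t ^ 2"
    by (induction t) (simp_all add: algebra_simps power2_eq_square)
  have "(\<Sum>k<2 * t + 1. \<bar>F k\<bar>) = (\<Sum>j<2 * t + 1. ?G j)"
    using sum_period_shift[of "\<lambda>k. \<bar>F k\<bar>" "2 * t + 1" "Suc z"] anti by simp
  also have "\<dots> = (\<Sum>j<t. ?G j + ?G (2 * t - j)) + ?G t" by (rule split)
  also have "\<dots> \<le> (\<Sum>j<t. 2 * a + 4 * a * real j) + (a + 2 * a * t)"
    by (intro add_mono sum_mono mid pair) simp
  also have "\<dots> = a * (2 * real t ^ 2 + 2 * real t + 1)"
    unfolding gauss by (simp add: algebra_simps)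
  finally show ?thesis .
qed

section \<open>The quadratic form of a band matrix of signs\<close>

definition far :: "nat \<Rightarrow> nat \<Rightarrow> nat \<Rightarrow> bool" where
  "far t i j \<longleftrightarrow> i + t < j \<or> j + t < i"

text \<open>
  The sign of the inner product of the rays at angles \<open>i \<pi> / (2t + 1)\<close> and \<open>j \<pi> / (2t + 1)\<close>, for
  labels at most \<open>2t\<close>.
\<close>

definition band_sign :: "nat \<Rightarrow> nat \<Rightarrow> nat \<Rightarrow> real" where
  "band_sign t i j = (if far t i j then -1 else 1)"

text \<open>
  Equality holds when every \<open>X i\<close> is \<open>a\<close>, which corresponds to the unswitched threshold graph.
\<close>

lemma band_form_le:
  fixes X :: "nat \<Rightarrow> real"
  assumes X: "\<And>i. i < 2 * t + 1 \<Longrightarrow> \<bar>X i\<bar> \<le> a"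
  shows "(\<Sum>i<2 * t + 1. \<Sum>j<2 * t + 1. band_sign t i j * X i * X j)
    \<le> a ^ 2 * (2 * real t ^ 2 + 2 * real t + 1)"
proof -
  let ?N = "2 * t + 1"
  have a0: "0 \<le> a" using X[of 0] by simp
  define Y where "Y k = (\<Sum>j<?N. band_sign t k j * X j)" for k
  \<comment> \<open>From \<open>k\<close> to \<open>k + 1\<close> the band gains the column \<open>k + 1 + t\<close> and loses the column \<open>k - t\<close>. Exactly
    one of these exists.\<close>
  have step: "\<bar>Y (Suc k) - Y k\<bar> \<le> 2 * a" if k: "Suc k < ?N" for k
  proof -
    let ?m = "if k < t then Suc k + t else k - t"
    have m: "?m < ?N" using k by auto
    have "Y (Suc k) - Y k = (\<Sum>j<?N. (band_sign t (Suc k) j - band_sign t k j) * X j)"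
      by (simp add: Y_def sum_subtractf left_diff_distrib del: sum.lessThan_Suc)
    also have "\<dots> = (\<Sum>j<?N. if j = ?m then (if k < t then 2 else -2) * X j else 0)"
      using k by (intro sum.cong) (auto simp: band_sign_def far_def)
    also have "\<dots> = (if k < t then 2 else -2) * X ?m"
      using m by (subst sum.delta) auto
    finally show ?thesis using X[OF m] by (simp add: abs_mult split: if_splits)
  qed
  \<comment> \<open>The same step from the last row to the negated first row: these rows differ only in column \<open>t\<close>.\<close>
  have wrap: "\<bar>Y 0 + Y (2 * t)\<bar> \<le> 2 * a"
  proof -
    have "Y 0 + Y (2 * t) = (\<Sum>j<?N. (band_sign t 0 j + band_sign t (2 * t) j) * X j)"
      by (simp add: Y_def sum.distrib distrib_right del: sum.lessThan_Suc)
    also have "\<dots> = (\<Sum>j<?N. if j = t then 2 * X j else 0)"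
      by (intro sum.cong) (auto simp: band_sign_def far_def)
    also have "\<dots> = 2 * X t" by (simp add: sum.delta)
    finally show ?thesis using X[of t] by simp
  qed
  \<comment> \<open>The antiperiodic extension: rows continue with the opposite sign after half a turn.\<close>
  define F where "F k = (-1) ^ (k div ?N) * Y (k mod ?N)" for k
  have anti: "F (k + ?N) = - F k" for k
    unfolding F_def by (subst div_add_self2) (simp_all only: mod_add_self2, simp_all)
  have Fstep: "\<bar>F (Suc k) - F k\<bar> \<le> 2 * a" for k
  proof (cases "Suc (k mod ?N) = ?N")
    case True
    then have "Suc k mod ?N = 0" "Suc k div ?N = Suc (k div ?N)" "k mod ?N = 2 * t"
      by (simp_all only: mod_Suc div_Suc) simp_all
    then have "F (Suc k) - F k = - ((-1) ^ (k div ?N)) * (Y 0 + Y (2 * t))"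
      by (simp only: F_def) (simp add: algebra_simps)
    then show ?thesis using wrap by (simp add: abs_mult power_abs)
  next
    case False
    then have "Suc k mod ?N = Suc (k mod ?N)" "Suc k div ?N = k div ?N"
      by (simp_all only: mod_Suc div_Suc) simp_all
    then have "F (Suc k) - F k = (-1) ^ (k div ?N) * (Y (Suc (k mod ?N)) - Y (k mod ?N))"
      by (simp only: F_def) (simp add: algebra_simps)
    moreover have "Suc (k mod ?N) < ?N"
      using False mod_less_divisor[of ?N k] by linarith
    ultimately show ?thesis using step by (simp add: abs_mult power_abs)
  qed
  have "(\<Sum>i<?N. \<Sum>j<?N. band_sign t i j * X i * X j) = (\<Sum>i<?N. X i * Y i)"
    by (simp add: Y_def sum_distrib_left ac_simps del: sum.lessThan_Suc)
  also have "\<dots> \<le> (\<Sum>i<?N. a * \<bar>F i\<bar>)"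
  proof (rule sum_mono)
    fix i assume "i \<in> {..<?N}"
    then have "F i = Y i" "\<bar>X i\<bar> \<le> a" using X by (auto simp: F_def)
    then have "\<bar>X i\<bar> * \<bar>Y i\<bar> \<le> a * \<bar>F i\<bar>"
      by (simp add: mult_right_mono)
    then show "X i * Y i \<le> a * \<bar>F i\<bar>"
      using abs_ge_self[of "X i * Y i"] by (simp add: abs_mult)
  qed
  also have "\<dots> = a * (\<Sum>i<?N. \<bar>F i\<bar>)" by (simp only: sum_distrib_left)
  also have "\<dots> \<le> a * (a * (2 * real t ^ 2 + 2 * real t + 1))"
    using antiperiodic_sum_abs_le[of F t a] anti Fstep a0 by (intro mult_left_mono) auto
  finally show ?thesis by (simp add: power2_eq_square mult.assoc)
qed

section \<open>The threshold graph\<close>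

definition bit_sign :: "bit \<Rightarrow> real" where
  "bit_sign b = (if b = 0 then 1 else -1)"

lemma bit_sign_add: "bit_sign (a + b) = bit_sign a * bit_sign b"
  by (cases a; cases b) (auto simp: bit_sign_def)

text \<open>
  The norm of a 1-cochain as a quadratic expression. The diagonal is counted as \<open>1\<close> because it
  then agrees with the product of a sign with itself.
\<close>

lemma sum_bit_sign_edges:
  assumes "finite V"
  shows "(\<Sum>u\<in>V. \<Sum>v\<in>V. if u = v then 1 else bit_sign (g {u, v}))
    = real (card V) ^ 2 - 4 * real (cochain_norm 1 (full_simplex V) g)"
proof -
  let ?E = "{e \<in> simplices 1 (full_simplex V). g e = 1}"
  let ?D = "{(u, v). u \<in> V \<and> v \<in> V \<and> u \<noteq> v \<and> g {u, v} = 1}"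
  define ends where "ends e = {(u, v). u \<noteq> v \<and> {u, v} = e}" for e :: "'a set"
  have fE: "finite ?E" by (simp add: assms finite_simplices_full_simplex)
  have ends: "finite (ends e) \<and> card (ends e) = 2" if "e \<in> ?E" for e
  proof -
    have "card e = 2" using that by (simp add: simplices_full_simplex)
    then obtain x y where xy: "e = {x, y}" "x \<noteq> y"
      unfolding card_2_iff by blast
    then have "ends e = {(x, y), (y, x)}" by (auto simp: ends_def doubleton_eq_iff)
    then show ?thesis using xy(2) by simp
  qed
  have "?D = (\<Union>e\<in>?E. ends e)"
    by (auto simp: ends_def simplices_full_simplex)
  also have "card \<dots> = (\<Sum>e\<in>?E. card (ends e))"
    using fE ends by (intro card_UN_disjoint) (auto simp: ends_def)
  also have "\<dots> = 2 * card ?E" using ends by simp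
  finally have D: "card ?D = 2 * cochain_norm 1 (full_simplex V) g"
    by (simp add: cochain_norm_def)
  have "(\<Sum>u\<in>V. \<Sum>v\<in>V. if u = v then 1 else bit_sign (g {u, v}))
      = (\<Sum>u\<in>V. \<Sum>v\<in>V. 1 - 2 * of_bool ((u, v) \<in> ?D))"
    by (intro sum.cong) (auto simp: bit_sign_def)
  also have "\<dots> = (\<Sum>p\<in>V \<times> V. 1 - 2 * of_bool (p \<in> ?D))"
    unfolding sum.cartesian_product by (intro sum.cong) auto
  also have "\<dots> = real (card V) ^ 2 - 2 * (\<Sum>p\<in>V \<times> V. of_bool (p \<in> ?D))"
    by (simp only: sum_subtractf sum_distrib_left[symmetric])
      (simp add: card_cartesian_product power2_eq_square)
  also have "(\<Sum>p\<in>V \<times> V. of_bool (p \<in> ?D)) = real (card ?D)"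
  proof -
    have "V \<times> V \<inter> {p. p \<in> ?D} = ?D" by auto
    then show ?thesis using assms by (simp add: sum_of_bool_eq)
  qed
  finally show ?thesis by (simp add: D)
qed

definition threshold_graph :: "nat \<Rightarrow> ('a \<Rightarrow> nat) \<Rightarrow> 'a set \<Rightarrow> 'a set \<Rightarrow> bit" where
  "threshold_graph t r V \<sigma> = of_bool (\<exists>u\<in>V. \<exists>w\<in>V. \<sigma> = {u, w} \<and> r u + t < r w)"

lemma threshold_graph_edge:
  assumes "u \<in> V" "v \<in> V"
  shows "threshold_graph t r V {u, v} = of_bool (far t (r u) (r v))"
  using assms by (auto simp: threshold_graph_def far_def doubleton_eq_iff)

lemma threshold_graph_in_cochains: "threshold_graph t r V \<in> cochains 1 (full_simplex V)"
proof -
  have "{u, w} \<in> simplices 1 (full_simplex V)" if "u \<in> V" "w \<in> V" "r u + t < r w" for u w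
  proof -
    have "u \<noteq> w" using that by auto
    then show ?thesis using that by (simp add: simplices_full_simplex)
  qed
  then show ?thesis by (auto simp: cochains_def threshold_graph_def)
qed

locale balanced_labelling =
  fixes V :: "'a set" and r :: "'a \<Rightarrow> nat" and c t :: nat
  assumes finite_V: "finite V"
    and labels: "r ` V \<subseteq> {..<2 * t + 1}"
    and fibre: "i < 2 * t + 1 \<Longrightarrow> card {v \<in> V. r v = i} = c"
begin

lemma card_V: "card V = c * (2 * t + 1)"
proof -
  have "card V = (\<Sum>i<2 * t + 1. \<Sum>v | v \<in> V \<and> r v = i. 1)"
    using sum.group[of V "{..<2 * t + 1}" r "\<lambda>_. 1 :: nat"] finite_V labels by simp
  also have "\<dots> = (\<Sum>i<2 * t + 1. c)" using fibre by (intro sum.cong) auto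
  finally show ?thesis by simp
qed

lemma sum_over_labels:
  fixes K :: "nat \<Rightarrow> real"
  shows "(\<Sum>v\<in>V. K (r v) * x v) = (\<Sum>i<2 * t + 1. K i * (\<Sum>v | v \<in> V \<and> r v = i. x v))"
proof -
  have "(\<Sum>v\<in>V. K (r v) * x v) = (\<Sum>i<2 * t + 1. \<Sum>v | v \<in> V \<and> r v = i. K (r v) * x v)"
    using sum.group[of V "{..<2 * t + 1}" r "\<lambda>v. K (r v) * x v"] finite_V labels by simp
  also have "\<dots> = (\<Sum>i<2 * t + 1. \<Sum>v | v \<in> V \<and> r v = i. K i * x v)"
    by (intro sum.cong) auto
  finally show ?thesis by (simp only: sum_distrib_left)
qed

text \<open>
  In terms of signs, switching multiplies the entry of \<open>u\<close> and \<open>v\<close> by the signs of \<open>u\<close> and \<open>v\<close>. Since the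
  unswitched entries depend on labels only, the sum over pairs of vertices collapses to a band form
  in the sums of signs over the fibres of \<open>r\<close>.
\<close>

lemma threshold_graph_norm_ge:
  "c ^ 2 * (t * (t + 1))
    \<le> 2 * cochain_norm 1 (full_simplex V)
        (\<lambda>\<sigma>. threshold_graph t r V \<sigma> + coboundary 0 (full_simplex V) d \<sigma>)"
    (is "_ \<le> 2 * ?norm")
proof -
  define x where "x v = bit_sign (d {v})" for v
  define X where "X i = (\<Sum>v | v \<in> V \<and> r v = i. x v)" for i
  have x: "\<bar>x v\<bar> = 1" "x v * x v = 1" for v by (auto simp: x_def bit_sign_def)
  have X: "\<bar>X i\<bar> \<le> c" if "i < 2 * t + 1" for i
  proof -
    have "\<bar>X i\<bar> \<le> (\<Sum>v | v \<in> V \<and> r v = i. \<bar>x v\<bar>)" unfolding X_def by (rule sum_abs)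
    then show ?thesis using fibre[OF that] by (simp add: x)
  qed
  have "real (card V) ^ 2 - 4 * real ?norm = (\<Sum>u\<in>V. \<Sum>v\<in>V. if u = v then 1 else
      bit_sign (threshold_graph t r V {u, v} + coboundary 0 (full_simplex V) d {u, v}))"
    by (rule sum_bit_sign_edges[OF finite_V, symmetric])
  also have "\<dots> = (\<Sum>u\<in>V. \<Sum>v\<in>V. band_sign t (r u) (r v) * x u * x v)"
  proof (intro sum.cong refl)
    fix u v assume uv: "u \<in> V" "v \<in> V"
    show "(if u = v then 1 else
        bit_sign (threshold_graph t r V {u, v} + coboundary 0 (full_simplex V) d {u, v}))
      = band_sign t (r u) (r v) * x u * x v"
    proof (cases "u = v")
      case True
      then show ?thesis by (simp add: band_sign_def far_def x mult.assoc)
    next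
      case False
      have "bit_sign (threshold_graph t r V {u, v}) = band_sign t (r u) (r v)"
        using uv by (auto simp: threshold_graph_edge bit_sign_def band_sign_def far_def)
      then show ?thesis
        using uv False by (simp add: coboundary_0_edge bit_sign_add x_def)
    qed
  qed
  also have "\<dots> = (\<Sum>u\<in>V. (\<Sum>j<2 * t + 1. band_sign t (r u) j * X j) * x u)"
  proof (rule sum.cong[OF refl])
    fix u assume "u \<in> V"
    have "(\<Sum>v\<in>V. band_sign t (r u) (r v) * x u * x v)
        = (\<Sum>v\<in>V. band_sign t (r u) (r v) * x v) * x u"
      by (simp add: sum_distrib_left ac_simps)
    then show "(\<Sum>v\<in>V. band_sign t (r u) (r v) * x u * x v)
        = (\<Sum>j<2 * t + 1. band_sign t (r u) j * X j) * x u"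
      by (simp only: sum_over_labels X_def)
  qed
  also have "\<dots> = (\<Sum>i<2 * t + 1. (\<Sum>j<2 * t + 1. band_sign t i j * X j) * X i)"
    unfolding X_def by (rule sum_over_labels)
  also have "\<dots> = (\<Sum>i<2 * t + 1. \<Sum>j<2 * t + 1. band_sign t i j * X i * X j)"
    by (simp add: sum_distrib_left ac_simps del: sum.lessThan_Suc)
  also have "\<dots> \<le> real c ^ 2 * (2 * real t ^ 2 + 2 * real t + 1)"
    using X by (rule band_form_le)
  finally have "real c ^ 2 * (real t * (real t + 1)) \<le> 2 * real ?norm"
    by (simp add: card_V power_mult_distrib power2_eq_square algebra_simps)
  then have "real (c ^ 2 * (t * (t + 1))) \<le> real (2 * ?norm)"
    by (simp add: algebra_simps)
  then show ?thesis by (simp only: of_nat_le_iff)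
qed

end

section \<open>Counting the odd triangles of the threshold graph\<close>

text \<open>
  Increasing triples of labels in which only the outer pair is far apart.
\<close>

definition odd_label_triples :: "nat \<Rightarrow> (nat \<times> nat \<times> nat) set" where
  "odd_label_triples t = {(i, j, k). i + t < k \<and> j \<le> i + t \<and> k \<le> j + t \<and> k < 2 * t + 1}"

text \<open>
  With \<open>p = k - t - 1\<close>, the first label \<open>i\<close> ranges over \<open>{..p}\<close> and the middle one lies between \<open>k - t = p + 1\<close> and
  \<open>i + t\<close>.
\<close>

lemma odd_label_triples_eq:
  "odd_label_triples t =
    (\<lambda>(p, i, j). (i, j, p + t + 1)) ` (SIGMA p:{..<t}. SIGMA i:{..p}. {p + 1..i + t})"
proof -
  have "(i, j, k) \<in> (\<lambda>(p, i, j). (i, j, p + t + 1)) ` (SIGMA p:{..<t}. SIGMA i:{..p}. {p + 1..i + t})"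
    if "(i, j, k) \<in> odd_label_triples t" for i j k
    using that by (intro image_eqI[of _ _ "(k - t - 1, i, j)"]) (auto simp: odd_label_triples_def)
  then show ?thesis by (auto simp: odd_label_triples_def)
qed

lemma finite_odd_label_triples: "finite (odd_label_triples t)"
  by (simp add: odd_label_triples_eq)

lemma card_odd_label_triples_le: "6 * card (odd_label_triples t) \<le> t * (t + 1) * (2 * t + 1)"
proof -
  have inner: "2 * (\<Sum>i\<le>p. real (i + t - p)) = (real p + 1) * (2 * real t - real p)" if "p < t" for p
  proof -
    \<comment> \<open>Only the upper limit takes part in the induction; \<open>p\<close> in the summand stays fixed.\<close>
    have "2 * (\<Sum>i\<le>q. real (i + t - p)) = (real q + 1) * (2 * real t - 2 * real p + real q)" for q
      using that by (induction q) (simp_all add: of_nat_diff algebra_simps)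
    from this[of p] show ?thesis by simp
  qed
  \<comment> \<open>Likewise \<open>t\<close> stays fixed and the upper limit becomes \<open>s\<close>.\<close>
  have outer: "3 * (\<Sum>p<s. (real p + 1) * (2 * real t - real p))
      = real s * (real s + 1) * (3 * real t - real s + 1)" for s
    by (induction s) (simp_all add: algebra_simps)
  have "card (odd_label_triples t) \<le> card (SIGMA p:{..<t}. SIGMA i:{..p}. {p + 1..i + t})"
    unfolding odd_label_triples_eq by (intro card_image_le) simp
  also have "\<dots> = (\<Sum>p<t. \<Sum>i\<le>p. i + t - p)" by simp
  finally have "real (card (odd_label_triples t)) \<le> real (\<Sum>p<t. \<Sum>i\<le>p. i + t - p)"
    by (simp only: of_nat_le_iff)
  then have "6 * real (card (odd_label_triples t)) \<le> 6 * (\<Sum>p<t. \<Sum>i\<le>p. real (i + t - p))"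
    by (simp only: of_nat_sum)
  also have "\<dots> = 3 * (\<Sum>p<t. 2 * (\<Sum>i\<le>p. real (i + t - p)))"
    by (simp add: sum_distrib_left)
  also have "\<dots> = 3 * (\<Sum>p<t. (real p + 1) * (2 * real t - real p))"
    by (rule arg_cong[where f = "(*) 3"], rule sum.cong, rule refl, rule inner, simp)
  also have "\<dots> = real (t * (t + 1) * (2 * t + 1))"
    unfolding outer by (simp add: algebra_simps)
  finally have "real (6 * card (odd_label_triples t)) \<le> real (t * (t + 1) * (2 * t + 1))" by simp
  then show ?thesis by (simp only: of_nat_le_iff)
qed

text \<open>
  Three labels up to \<open>2t\<close> cannot be pairwise far apart, so an odd triangle has exactly one far pair,
  and its third label lies between that pair.
\<close>

lemma odd_label_triple_cases:
  assumes odd: "far t i j \<longleftrightarrow> (far t i k \<longleftrightarrow> far t j k)"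
    and range: "i < 2 * t + 1" "j < 2 * t + 1" "k < 2 * t + 1"
  shows "\<exists>(a, b, d) \<in> {(i, j, k), (i, k, j), (j, i, k), (j, k, i), (k, i, j), (k, j, i)}.
    (a, b, d) \<in> odd_label_triples t"
proof -
  have one: "(a, b, d) \<in> odd_label_triples t \<or> (d, b, a) \<in> odd_label_triples t"
    if "far t a d" "\<not> far t a b" "\<not> far t b d" "a < 2 * t + 1" "d < 2 * t + 1" for a b d
    using that by (auto simp: far_def odd_label_triples_def)
  have "\<not> (far t i j \<and> far t i k \<and> far t j k)"
    using range by (auto simp: far_def)
  moreover have sym: "far t a b \<longleftrightarrow> far t b a" for a b by (auto simp: far_def)
  ultimately consider "far t i k" "\<not> far t i j" "\<not> far t j k"
    | "far t i j" "\<not> far t i k" "\<not> far t k j" | "far t j k" "\<not> far t j i" "\<not> far t i k"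
    using odd by blast
  then show ?thesis
  proof cases
    case 1
    then show ?thesis using one[of i k j] range by blast
  next
    case 2
    then show ?thesis using one[of i j k] range by blast
  next
    case 3
    then show ?thesis using one[of j k i] range by blast
  qed
qed

context balanced_labelling
begin

text \<open>
  Every odd triangle, listed by increasing label, lies over a triple in \<open>odd_label_triples t\<close>, and there are \<open>c\<^sup>3\<close>
  ways to choose its vertices in the fibres.
\<close>

lemma odd_triangles_le:
  "6 * cochain_norm 2 (full_simplex V) (coboundary 1 (full_simplex V) (threshold_graph t r V))
    \<le> c ^ 3 * (t * (t + 1) * (2 * t + 1))"
proof -
  let ?X = "full_simplex V" and ?f = "threshold_graph t r V"
  let ?O = "{\<tau> \<in> simplices 2 ?X. coboundary 1 ?X ?f \<tau> = 1}"
  define fib where "fib i = {v \<in> V. r v = i}" for i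
  let ?T = "\<Union>(i, j, k)\<in>odd_label_triples t. fib i \<times> fib j \<times> fib k"
  have fin: "finite (fib i)" for i using finite_V by (simp add: fib_def)
  have fT: "finite ?T" using finite_odd_label_triples fin by auto
  have sub: "?O \<subseteq> (\<lambda>(u, v, w). {u, v, w}) ` ?T"
  proof
    fix \<tau> assume \<tau>: "\<tau> \<in> ?O"
    then obtain x y z where xyz: "\<tau> = {x, y, z}" "x \<noteq> y" "x \<noteq> z" "y \<noteq> z"
      by (auto simp: simplices_full_simplex card_3_iff)
    have V: "x \<in> V" "y \<in> V" "z \<in> V" using \<tau> xyz by (auto simp: simplices_full_simplex)
    have "?f {x, y} + ?f {x, z} + ?f {y, z} = 1"
      using \<tau> xyz V by (simp add: coboundary_1_triangle)
    then have "far t (r x) (r y) \<longleftrightarrow> (far t (r x) (r z) \<longleftrightarrow> far t (r y) (r z))"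
      using V by (auto simp: threshold_graph_edge split: if_splits)
    moreover have "r x < 2 * t + 1" "r y < 2 * t + 1" "r z < 2 * t + 1"
      using V labels by auto
    ultimately have "\<exists>(u, v, w)\<in>{(x, y, z), (x, z, y), (y, x, z), (y, z, x), (z, x, y), (z, y, x)}.
        (r u, r v, r w) \<in> odd_label_triples t"
      using odd_label_triple_cases[of t "r x" "r y" "r z"] by simp
    then obtain u v w where
      uvw: "(u, v, w) \<in> {(x, y, z), (x, z, y), (y, x, z), (y, z, x), (z, x, y), (z, y, x)}"
        "(r u, r v, r w) \<in> odd_label_triples t"
      by blast
    then have "{u, v, w} = \<tau>" "u \<in> V" "v \<in> V" "w \<in> V" using xyz V by auto
    then show "\<tau> \<in> (\<lambda>(u, v, w). {u, v, w}) ` ?T"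
      using uvw(2) by (intro image_eqI[of _ _ "(u, v, w)"]) (auto simp: fib_def)
  qed
  have "card ?O \<le> card ((\<lambda>(u, v, w). {u, v, w}) ` ?T)"
    using fT sub by (intro card_mono) auto
  also have "\<dots> \<le> card ?T" using fT by (rule card_image_le)
  also have "\<dots> \<le> (\<Sum>(i, j, k)\<in>odd_label_triples t. card (fib i \<times> fib j \<times> fib k))"
    using card_UN_le[OF finite_odd_label_triples, of "\<lambda>(i, j, k). fib i \<times> fib j \<times> fib k"]
    by (simp add: case_prod_unfold)
  also have "\<dots> = (\<Sum>_\<in>odd_label_triples t. c ^ 3)"
    using fibre by (intro sum.cong)
      (auto simp: odd_label_triples_def fib_def card_cartesian_product power3_eq_cube)
  finally have "6 * card ?O \<le> c ^ 3 * (6 * card (odd_label_triples t))"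
    by (simp add: mult.commute)
  also have "\<dots> \<le> c ^ 3 * (t * (t + 1) * (2 * t + 1))"
    by (intro mult_left_mono card_odd_label_triples_le) simp
  finally show ?thesis by (simp add: cochain_norm_def)
qed

end

section \<open>The first Cheeger constant\<close>

text \<open>
  The shift by one turns the vertices \<open>1, \<dots>, c (2t + 1)\<close> into the numbers below \<open>c (2t + 1)\<close>, of which \<open>c\<close> have
  any given residue.
\<close>

lemma balanced_labelling_residues:
  "balanced_labelling {1..c * (2 * t + 1)} (\<lambda>v. (v - 1) mod (2 * t + 1)) c t"
proof
  let ?N = "2 * t + 1"
  fix i assume i: "i < ?N"
  have "{v \<in> {1..c * ?N}. (v - 1) mod ?N = i} = (\<lambda>q. q * ?N + i + 1) ` {..<c}"
  proof (intro equalityI subsetI)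
    fix v assume v: "v \<in> {v \<in> {1..c * ?N}. (v - 1) mod ?N = i}"
    then have "(v - 1) div ?N < c"
      by (intro less_mult_imp_div_less) auto
    moreover have "v = (v - 1) div ?N * ?N + i + 1"
      using v div_mult_mod_eq[of "v - 1" ?N] by (simp only: mem_Collect_eq) auto
    ultimately show "v \<in> (\<lambda>q. q * ?N + i + 1) ` {..<c}" by blast
  next
    fix v assume "v \<in> (\<lambda>q. q * ?N + i + 1) ` {..<c}"
    then obtain q where q: "q < c" "v = q * ?N + i + 1" by blast
    have "Suc q * ?N \<le> c * ?N" using q(1) by (intro mult_right_mono) auto
    then have "v \<le> c * ?N" using i q(2) by simp
    moreover have "(v - 1) mod ?N = i"
      using i by (simp only: q(2) add_diff_cancel_right' mod_mult_self3 mod_less)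
    ultimately show "v \<in> {v \<in> {1..c * ?N}. (v - 1) mod ?N = i}" using q(2) by simp
  qed
  moreover have "inj_on (\<lambda>q. q * ?N + i + 1) {..<c}" 
    by (intro inj_onI) (simp only: add_right_cancel mult_cancel2, simp)
  ultimately show "card {v \<in> {1..c * ?N}. (v - 1) mod ?N = i} = c"
    by (simp add: card_image)
qed auto

theorem theorem4p2:
  fixes c t n :: nat
  assumes "c \<ge> 1" and "t \<ge> 1" and "n = c * (2 * t + 1)"
  shows "cheeger_constant 1 (full_simplex {1..n}) = real n / 3"
proof -
  let ?X = "full_simplex {1..n}"
  let ?ratio = "\<lambda>f. real (cochain_norm (1 + 1) ?X (coboundary 1 ?X f)) / real (cosystolic_norm 1 ?X f)"
  define f where "f = threshold_graph t (\<lambda>v. (v - 1) mod (2 * t + 1)) {1..n}"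
  interpret balanced_labelling "{1..n}" "\<lambda>v. (v - 1) mod (2 * t + 1)" c t
    unfolding assms(3) by (rule balanced_labelling_residues)
  have pos: "0 < cosystolic_norm 1 ?X g" if "g \<in> cochains 1 ?X - coboundaries 1 ?X" for g
    using that cosystolic_norm_eq_0_iff[of "{1..n}" g 1] by auto
  have lower: "real n / 3 \<le> ?ratio g" if "g \<in> cochains 1 ?X - coboundaries 1 ?X" for g
  proof -
    have "real (n * cosystolic_norm 1 ?X g) \<le> real (3 * cochain_norm 2 ?X (coboundary 1 ?X g))"
      using card_times_cosystolic_norm_le[of "{1..n}" g] by (simp only: of_nat_le_iff) simp
    then show ?thesis using pos[OF that] by (simp add: field_simps)
  qed
  have csy: "c ^ 2 * (t * (t + 1)) \<le> 2 * cosystolic_norm 1 ?X f"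
  proof -
    obtain d where "cosystolic_norm 1 ?X f
        = cochain_norm 1 ?X (\<lambda>\<sigma>. f \<sigma> + coboundary (1 - 1) ?X d \<sigma>)"
      by (rule cosystolic_norm_attained[OF finite_V])
    then show ?thesis using threshold_graph_norm_ge[of d] by (simp add: f_def)
  qed
  have "0 < c ^ 2 * (t * (t + 1))" using assms by simp
  then have csy_pos: "0 < cosystolic_norm 1 ?X f" using csy by linarith
  then have f: "f \<in> cochains 1 ?X - coboundaries 1 ?X"
    using threshold_graph_in_cochains cosystolic_norm_eq_0_iff[of "{1..n}" f 1] by (auto simp: f_def)
  have "6 * cochain_norm 2 ?X (coboundary 1 ?X f) \<le> c ^ 3 * (t * (t + 1) * (2 * t + 1))"
    unfolding f_def by (rule odd_triangles_le)
  also have "\<dots> = n * (c ^ 2 * (t * (t + 1)))"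
    by (simp add: assms(3) power2_eq_square power3_eq_cube algebra_simps)
  also have "\<dots> \<le> n * (2 * cosystolic_norm 1 ?X f)"
    using csy by (rule mult_left_mono) simp
  finally have "real (6 * cochain_norm 2 ?X (coboundary 1 ?X f)) \<le> real (n * (2 * cosystolic_norm 1 ?X f))"
    by (simp only: of_nat_le_iff)
  then have "?ratio f \<le> real n / 3" using csy_pos by (simp add: field_simps)
  then have attained: "real n / 3 = ?ratio f" using lower[OF f] by simp
  show ?thesis
    unfolding cheeger_constant_def
  proof (rule Min_eqI)
    show "finite (?ratio ` (cochains 1 ?X - coboundaries 1 ?X))"
      by (intro finite_imageI finite_Diff finite_cochains finite_simplicial_complex_full_simplex) simp
    show "real n / 3 \<in> ?ratio ` (cochains 1 ?X - coboundaries 1 ?X)"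
      using f attained by blast
  qed (use lower in blast)
qed

end
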